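(* For every $x\in\mathbb{C}$ with $\Re(x)>0$, $$K_{1/2}(x)=\sqrt{\frac{\pi}{2x}}\;e^{-x}.$$
   Context: For real non-integer $\alpha$ and $\Re(x)>0$, the modified Bessel functions are defined by $$I_{\alpha}(x)=\sum_{m=0}^{\infty}\frac{1}{m!\,\Gamma(m+\alpha+1)}\left(\frac{x}{2}\right)^{2m+\alpha},\qquad K_{\alpha}(x)=\frac{\pi}{2}\,\frac{I_{-\alpha}(x)-I_{\alpha}(x)}{\sin(\alpha\pi)} .$$ Powers and square roots are taken with the principal branch. *)

theory Defs
  imports "HOL-Analysis.Analysis"
begin

(* Complex powr is taken with the principal branch of the logarithm. *)
definition bessel_I :: "real \<Rightarrow> complex \<Rightarrow> complex" where
  "bessel_I \<alpha> x =
     (\<Sum>m. 1 / (fact m * Gamma (of_real (real m + \<alpha> + 1)))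
            * (x / 2) powr of_real (2 * real m + \<alpha>))"

(* Meaningful for non-integer order only: for integer \<alpha> the denominator vanishes and
   the value is 0 by the division convention, not the usual limit in \<alpha>. *)
definition bessel_K :: "real \<Rightarrow> complex \<Rightarrow> complex" where
  "bessel_K \<alpha> x =
     of_real (pi / 2) * ((bessel_I (- \<alpha>) x - bessel_I \<alpha> x) / of_real (sin (\<alpha> * pi)))"

end

theory Submission
  imports Defs
begin

text \<open>At half-integers the Gamma function reduces to factorials: m! Gamma(m + 1/2) = sqrt(pi)
  (2m)! / 4^m (\<open>fact_mult_Gamma_half\<close>), and similarly at m + 3/2. The series of orders
  -1/2 and 1/2 thereby become those of cosh and sinh, both divided by sqrt(pi) sqrt(x/2)
  (\<open>bessel_I_minus_half\<close>, \<open>bessel_I_half\<close>). Since sin(pi/2) = 1 and cosh x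
  - sinh x = exp(-x), only a question of branches remains: whether sqrt(pi) / (2 sqrt(x/2)) is the
  principal root of pi/(2x). Re x > 0 settles it.\<close>

lemma Gamma_nat_plus_three_halves:
  "Gamma (real m + 3 / 2) = (real m + 1 / 2) * Gamma (real m + 1 / 2)"
proof -
  have "real m + 1 / 2 \<notin> \<int>\<^sub>\<le>\<^sub>0"
    using nonpos_Ints_nonpos[of "real m + 1 / 2"] by auto
  then show ?thesis
    using Gamma_plus1[of "real m + 1 / 2"] by (simp add: add.assoc)
qed

text \<open>An instance of Legendre's duplication formula. The induction step rests on (m + 1)(m +
  1/2) = (2m + 1)(2m + 2) / 4.\<close>

lemma fact_mult_Gamma_half:
  "fact m * Gamma (real m + 1 / 2) = sqrt pi * fact (2 * m) / 4 ^ m"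
proof (induction m)
  case 0
  then show ?case by (simp add: Gamma_one_half_real)
next
  case (Suc m)
  have "fact (Suc m) * Gamma (real (Suc m) + 1 / 2)
      = (real m + 1) * (real m + 1 / 2) * (fact m * Gamma (real m + 1 / 2))"
    using Gamma_nat_plus_three_halves[of m] by (simp add: algebra_simps)
  also have "\<dots> = sqrt pi * fact (2 * Suc m) / 4 ^ Suc m"
    unfolding Suc.IH by (simp add: field_simps)
  finally show ?case .
qed

lemma fact_mult_Gamma_three_halves:
  "fact m * Gamma (real m + 3 / 2) = sqrt pi * fact (2 * m + 1) / (2 * 4 ^ m)"
proof -
  have "fact m * Gamma (real m + 3 / 2) = (real m + 1 / 2) * (fact m * Gamma (real m + 1 / 2))"
    using Gamma_nat_plus_three_halves[of m] by simp
  then show ?thesis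
    unfolding fact_mult_Gamma_half by (simp add: field_simps)
qed

text \<open>The odd terms of the full power series vanish, so summing along the indices 2m loses
  nothing.\<close>

lemma cosh_sums_even:
  fixes x :: "'a :: {banach, real_normed_field}"
  shows "(\<lambda>m. x ^ (2 * m) / fact (2 * m)) sums cosh x"
proof -
  have "(\<lambda>m. (\<lambda>n. if even n then x ^ n /\<^sub>R fact n else 0) (2 * m)) sums cosh x"
    by (subst sums_mono_reindex) (auto simp: strict_mono_def cosh_converges elim!: evenE)
  then show ?thesis
    by (simp add: scaleR_conv_of_real field_simps)
qed

lemma sinh_sums_odd:
  fixes x :: "'a :: {banach, real_normed_field}"
  shows "(\<lambda>m. x ^ (2 * m + 1) / fact (2 * m + 1)) sums sinh x"
proof -
  have "(\<lambda>m. (\<lambda>n. if even n then 0 else x ^ n /\<^sub>R fact n) (2 * m + 1)) sums sinh x"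
    by (subst sums_mono_reindex) (auto simp: strict_mono_def sinh_converges elim!: oddE)
  then show ?thesis
    by (simp add: scaleR_conv_of_real field_simps del: fact_Suc)
qed

text \<open>For a fixed nonzero base the principal power turns sums of exponents into products, so
  no branch correction appears.\<close>

lemma powr_add_half_eq:
  assumes "z \<noteq> 0"
  shows "z powr of_real (2 * real m + 1 / 2) = z ^ (2 * m) * csqrt z"
    and "z powr of_real (2 * real m - 1 / 2) = z ^ (2 * m) / csqrt z"
proof -
  have *: "z powr of_real (2 * real m) = z ^ (2 * m)"
    using assms powr_nat'[of z "2 * m"] by simp
  show "z powr of_real (2 * real m + 1 / 2) = z ^ (2 * m) * csqrt z"
    using assms * by (simp add: powr_add csqrt_conv_powr)
  show "z powr of_real (2 * real m - 1 / 2) = z ^ (2 * m) / csqrt z"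
    using assms * by (simp add: powr_diff csqrt_conv_powr)
qed

text \<open>The 4^m from the Gamma product cancels against the denominator of (x/2)^(2m).\<close>

lemma bessel_I_minus_half:
  assumes "x \<noteq> 0"
  shows "bessel_I (- (1 / 2)) x = cosh x / (of_real (sqrt pi) * csqrt (x / 2))"
proof -
  have "1 / (fact m * Gamma (of_real (real m + - (1 / 2) + 1)))
            * (x / 2) powr of_real (2 * real m + - (1 / 2))
        = (x ^ (2 * m) / fact (2 * m)) / (of_real (sqrt pi) * csqrt (x / 2))" for m
  proof -
    have "fact m * Gamma (of_real (real m + - (1 / 2) + 1) :: complex)
        = of_real (fact m * Gamma (real m + 1 / 2))"
      unfolding of_real_mult Gamma_complex_of_real of_real_fact by (simp add: add.commute)
    also have "\<dots> = of_real (sqrt pi) * fact (2 * m) / 2 ^ (2 * m)"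
      unfolding fact_mult_Gamma_half by (simp add: power_mult)
    finally have G: "fact m * Gamma (of_real (real m + - (1 / 2) + 1) :: complex) = \<dots>" .
    have P: "(x / 2) powr of_real (2 * real m + - (1 / 2)) = (x / 2) ^ (2 * m) / csqrt (x / 2)"
      using powr_add_half_eq(2)[of "x / 2" m] assms by simp
    show ?thesis
      unfolding G P by (simp add: power_divide)
  qed
  then show ?thesis
    unfolding bessel_I_def by (simp only: sums_unique[OF sums_divide[OF cosh_sums_even], symmetric])
qed

lemma bessel_I_half:
  assumes "x \<noteq> 0"
  shows "bessel_I (1 / 2) x = sinh x / (of_real (sqrt pi) * csqrt (x / 2))"
proof -
  have "1 / (fact m * Gamma (of_real (real m + 1 / 2 + 1)))
            * (x / 2) powr of_real (2 * real m + 1 / 2)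
        = (x ^ (2 * m + 1) / fact (2 * m + 1)) / (of_real (sqrt pi) * csqrt (x / 2))" for m
  proof -
    have "fact m * Gamma (of_real (real m + 1 / 2 + 1) :: complex)
        = of_real (fact m * Gamma (real m + 3 / 2))"
      unfolding of_real_mult Gamma_complex_of_real of_real_fact by (simp add: add.commute)
    also have "\<dots> = of_real (sqrt pi) * fact (2 * m + 1) / (2 * 2 ^ (2 * m))"
      unfolding fact_mult_Gamma_three_halves by (simp add: power_mult)
    finally have G: "fact m * Gamma (of_real (real m + 1 / 2 + 1) :: complex) = \<dots>" .
    have P: "(x / 2) powr of_real (2 * real m + 1 / 2) = (x / 2) ^ (2 * m) * csqrt (x / 2)"
      using powr_add_half_eq(1)[of "x / 2" m] assms by simp
    \<comment> \<open>Moving the root to the denominator supplies the extra factor x of the odd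
      powers, and gives the same denominator as for order -1/2.\<close>
    have S: "csqrt (x / 2) = x / 2 / csqrt (x / 2)"
      using assms power2_csqrt[of "x / 2"] by (simp add: field_simps power2_eq_square)
    show ?thesis
      unfolding G P by (subst S) (simp add: power_divide mult_ac del: fact_Suc)
  qed
  then show ?thesis
    unfolding bessel_I_def by (simp only: sums_unique[OF sums_divide[OF sinh_sums_odd], symmetric])
qed

theorem mainTheorem5:
  fixes x :: complex
  assumes "Re x > 0"
  shows "bessel_K (1 / 2) x = csqrt (of_real pi / (2 * x)) * exp (- x)"
proof -
  define s where "s = csqrt (x / 2)"
  have x0: "x \<noteq> 0"
    using assms by auto
  have s2: "s\<^sup>2 = x / 2"
    by (simp add: s_def)
  have s0: "s \<noteq> 0"
    using x0 by (simp add: s_def)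
  \<comment> \<open>A principal root has nonnegative real part; were it 0, the square would be a
    nonpositive real, against Re (x/2) > 0.\<close>
  have "Re s > 0"
  proof (rule ccontr)
    assume "\<not> Re s > 0"
    then have "Re s = 0"
      using Re_csqrt[of "x / 2"] by (simp add: s_def)
    then have "Re (s\<^sup>2) \<le> 0"
      by (simp add: power2_eq_square)
    then show False
      using assms by (simp add: s2)
  qed
  \<comment> \<open>Inversion preserves the sign of the real part, and a square root with positive
    real part is the principal one.\<close>
  then have "0 < Re (of_real (sqrt pi) / (2 * s))"
    by (simp add: Re_divide add_pos_nonneg)
  moreover have "(of_real (sqrt pi) / (2 * s))\<^sup>2 = of_real pi / (2 * x)"
    using x0 by (simp add: power_divide power_mult_distrib s2 flip: of_real_power)
  ultimately have root: "csqrt (of_real pi / (2 * x)) = of_real (sqrt pi) / (2 * s)"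
    by (intro csqrt_unique) auto
  have pi: "(of_real pi :: complex) = of_real (sqrt pi) * of_real (sqrt pi)"
    by (simp flip: of_real_mult)
  have "bessel_K (1 / 2) x = of_real (pi / 2) * ((cosh x - sinh x) / (of_real (sqrt pi) * s))"
    unfolding bessel_K_def bessel_I_minus_half[OF x0] bessel_I_half[OF x0] s_def
    by (simp add: diff_divide_distrib)
  also have "\<dots> = of_real (sqrt pi) / (2 * s) * exp (- x)"
    unfolding cosh_minus_sinh using s0 by (simp add: pi)
  finally show ?thesis
    unfolding root .
qed

end
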